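(* Let $\mathcal{X},\mathcal{Y},\mathcal{Z}\in\Lambda$, with $\mathcal{X}$ and $\mathcal{Y}$ independent and $\mathcal{Z}\subset\mathcal{X}+\mathcal{Y}$. Then the following statements are equivalent. (i) $\mathcal{Z}=(\mathcal{X}\land\mathcal{Z})\lor(\mathcal{Y}\land\mathcal{Z})$, i.e. $\mathcal{X}\land\mathcal{Z}$ is a complement of $\mathcal{Y}\land\mathcal{Z}$ in $\mathcal{Z}$. (ii) $\mathcal{X}$ and $\mathcal{Y}$ are conditionally independent given $\mathcal{Z}$; moreover $\mathbb{P}[Y\vert\mathcal{Z}]$ is $\mathcal{Y}$-measurable for every $Y\in\mathcal{Y}$, and $\mathbb{P}[X\vert\mathcal{Z}]$ is $\mathcal{X}$-measurable for every $X\in\mathcal{X}$.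
   Context: $(\Omega,\mathcal{M},\mathbb{P})$ is a probability space ($\mathbb{P}$ itself need not be complete). $0_\Lambda:=\mathbb{P}^{-1}(\{0,1\})$ is the collection of all events of $\mathcal{M}$ having probability $0$ or $1$. A sub-$\sigma$-field of $\mathcal{M}$ is called complete if it contains $0_\Lambda$, and $\Lambda$ denotes the collection of all complete sub-$\sigma$-fields of $\mathcal{M}$. For $\mathcal{X},\mathcal{Y}\in\Lambda$: $\mathcal{X}\land\mathcal{Y}:=\mathcal{X}\cap\mathcal{Y}$; $\mathcal{X}\lor\mathcal{Y}:=\sigma(\mathcal{X}\cup\mathcal{Y})$; when $\mathcal{X}$ and $\mathcal{Y}$ are independent under $\mathbb{P}$, one writes $\mathcal{X}+\mathcal{Y}:=\mathcal{X}\lor\mathcal{Y}$ (so writing $\mathcal{X}+\mathcal{Y}$ entails that $\mathcal{X}$ and $\mathcal{Y}$ are independent). $\mathcal{Y}$ is called a complement of $\mathcal{X}$ in $\mathcal{Z}$ if $\mathcal{Z}=\mathcal{X}+\mathcal{Y}$. $\mathbb{P}[F\vert\mathcal{Z}]$ denotes the conditional probability of $F\in\mathcal{M}$ given $\mathcal{Z}$ (versions are a.s. equal; as all $\sigma$-fields are complete, measurability does not depend on the chosen version). *)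

theory Defs
  imports "HOL-Probability.Probability"
begin

definition zero_one_events :: "'a measure \<Rightarrow> 'a set set" where
  "zero_one_events M = {A \<in> sets M. measure M A \<in> {0, 1}}"

text \<open>A sub-\<open>\<sigma>\<close>-field is represented by its family of sets. Completeness refers only to
  null and almost sure sets that are measurable; \<open>M\<close> itself need not be complete.\<close>

definition complete_subfields :: "'a measure \<Rightarrow> 'a set set set" where
  "complete_subfields M =
    {X. sigma_algebra (space M) X \<and> X \<subseteq> sets M \<and> zero_one_events M \<subseteq> X}"

definition sigma_join :: "'a measure \<Rightarrow> 'a set set \<Rightarrow> 'a set set \<Rightarrow> 'a set set" where
  "sigma_join M X Y = sigma_sets (space M) (X \<union> Y)"

text \<open>\<open>is_complement M Y X Z\<close> reads: \<open>Y\<close> is a complement of \<open>X\<close> in \<open>Z\<close>, that is \<open>Z = X + Y\<close>,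
  where writing \<open>X + Y\<close> for the join entails independence.\<close>

definition is_complement :: "'a measure \<Rightarrow> 'a set set \<Rightarrow> 'a set set \<Rightarrow> 'a set set \<Rightarrow> bool" where
  "is_complement M Y X Z \<longleftrightarrow>
    X \<in> complete_subfields M \<and> Y \<in> complete_subfields M \<and>
    prob_space.indep_set M X Y \<and> Z = sigma_join M X Y"

text \<open>The version of the conditional probability of \<open>F\<close> given \<open>Z\<close> chosen by
  \<^const>\<open>real_cond_exp\<close>. Any other version differs from it on an event of probability zero, so
  measurability with respect to a complete sub-\<open>\<sigma>\<close>-field does not depend on this choice.\<close>

definition cond_prob_given :: "'a measure \<Rightarrow> 'a set set \<Rightarrow> 'a set \<Rightarrow> 'a \<Rightarrow> real" where
  "cond_prob_given M Z F = real_cond_exp M (sigma (space M) Z) (indicator F)"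

definition cond_indep_given ::
    "'a measure \<Rightarrow> 'a set set \<Rightarrow> 'a set set \<Rightarrow> 'a set set \<Rightarrow> bool" where
  "cond_indep_given M Z X Y \<longleftrightarrow>
    (\<forall>A\<in>X. \<forall>B\<in>Y. AE w in M.
      cond_prob_given M Z (A \<inter> B) w = cond_prob_given M Z A w * cond_prob_given M Z B w)"

end

theory Submission
  imports Defs
begin

text \<open>
  Write \<open>A = X \<inter> Z\<close> and \<open>B = Y \<inter> Z\<close>. If \<open>Z = A \<or> B\<close>, then independence gives
  \<open>P(a \<inter> b | Z) = P(a | A) P(b | B)\<close> for \<open>a \<in> X\<close>, \<open>b \<in> Y\<close>, as one checks on the generating events
  \<open>c \<inter> d\<close> with \<open>c \<in> A\<close>, \<open>d \<in> B\<close>; all of (ii) follows. Conversely, under (ii) the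
  variable \<open>P(a \<inter> b | Z) = P(a | Z) P(b | Z)\<close> is measurable with respect to \<open>W = A \<or> B\<close>. Therefore, for
  \<open>z \<in> Z\<close>, the indicator of \<open>z\<close> and its conditional expectation given \<open>W\<close> have the same integral over
  each \<open>a \<inter> b\<close>, hence over every event of \<open>X \<or> Y\<close>. Both being \<open>X \<or> Y\<close>-measurable, they agree
  almost surely, and so \<open>z \<in> W\<close> by completeness.
\<close>

section \<open>Identifying conditional expectations on an intersection-stable generator\<close>

text \<open>A Dynkin argument carried out on integrals rather than measures, since \<open>f\<close>
  and \<open>g\<close> may change sign. Integrability gives additivity over countable disjoint
  unions; membership of \<open>space M\<close> in \<open>G\<close> equates the total integrals, from
  which complements are obtained by subtraction.\<close>

lemma set_integral_eq_on_generator: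
  fixes f g :: "'a \<Rightarrow> real"
  assumes "Int_stable G" "G \<subseteq> sets M" "space M \<in> G"
    and int: "integrable M f" "integrable M g"
    and eq: "\<And>C. C \<in> G \<Longrightarrow> (\<integral>x\<in>C. f x \<partial>M) = (\<integral>x\<in>C. g x \<partial>M)"
    and "C \<in> sigma_sets (space M) G"
  shows "(\<integral>x\<in>C. f x \<partial>M) = (\<integral>x\<in>C. g x \<partial>M)"
proof -
  have sub: "sigma_sets (space M) G \<subseteq> sets M"
    using assms(2) by (rule sets.sigma_sets_subset)
  have si: "set_integrable M C f" "set_integrable M C g" if "C \<in> sets M" for C
    unfolding set_integrable_def
    by (rule integrable_mult_indicator[OF that int(1)], rule integrable_mult_indicator[OF that int(2)])
  have "G \<subseteq> Pow (space M)" using assms(2) sets.space_closed by (rule subset_trans)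
  from assms(1) this assms(7) show ?thesis
  proof (induction rule: sigma_sets_induct_disjoint)
    case (basic C)
    then show ?case by (rule eq)
  next
    case empty
    show ?case by (simp add: set_lebesgue_integral_def)
  next
    case (compl C)
    have C: "C \<in> sets M" using compl sub by auto
    \<comment> \<open>Proved for a generic \<open>h\<close> so that it serves both \<open>f\<close>
      and \<open>g\<close>.\<close>
    have "(\<integral>x\<in>space M - C. h x \<partial>M) = (\<integral>x\<in>space M. h x \<partial>M) - (\<integral>x\<in>C. h x \<partial>M)"
      if h: "integrable M h" for h :: "'a \<Rightarrow> real"
    proof -
      have hi: "set_integrable M D h" if "D \<in> sets M" for D
        unfolding set_integrable_def by (rule integrable_mult_indicator[OF that h])
      have "(space M - C) \<union> C = space M" using sets.sets_into_space[OF C] by auto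
      then show ?thesis
        using set_integral_Un[of "space M - C" C M h, OF _ hi hi] C by (simp add: Int_commute)
    qed
    then show ?case using int compl eq[OF assms(3)] by simp
  next
    case (union C)
    have C: "C i \<in> sets M" for i using union sub by auto
    have d: "C i \<inter> C j = {}" if "i \<noteq> j" for i j
      using union(1) that by (auto simp: disjoint_family_on_def)
    have U: "(\<Union>i. C i) \<in> sets M" using C by auto
    show ?case
      using lebesgue_integral_countable_add[of C M f, OF C d si(1)[OF U]]
        lebesgue_integral_countable_add[of C M g, OF C d si(2)[OF U]] union(3) by simp
  qed
qed

text \<open>The averaging property that characterizes conditional expectation extends from
  \<open>G\<close> to all of \<open>F\<close> by the preceding lemma. It is applied below to joins,
  whose general events have no explicit description.\<close>

lemma (in sigma_finite_subalgebra) real_cond_exp_charact_generator: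
  assumes "Int_stable G" "G \<subseteq> sets M" "space M \<in> G" "sets F = sigma_sets (space M) G"
    and "integrable M f" "integrable M g" "g \<in> borel_measurable F"
    and "\<And>C. C \<in> G \<Longrightarrow> (\<integral>x\<in>C. f x \<partial>M) = (\<integral>x\<in>C. g x \<partial>M)"
  shows "AE x in M. real_cond_exp M F f x = g x"
proof (rule real_cond_exp_charact[OF _ assms(5-7)])
  fix C assume "C \<in> sets F"
  then have "C \<in> sigma_sets (space M) G" by (simp only: assms(4))
  with assms(1-3,5,6,8) show "(\<integral>x\<in>C. f x \<partial>M) = (\<integral>x\<in>C. g x \<partial>M)"
    by (rule set_integral_eq_on_generator)
qed

lemma Int_stable_pairwise_Int:
  assumes "Int_stable A" "Int_stable B"
  shows "Int_stable {a \<inter> b | a b. a \<in> A \<and> b \<in> B}"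
proof (rule Int_stableI)
  fix u v assume "u \<in> {a \<inter> b | a b. a \<in> A \<and> b \<in> B}" "v \<in> {a \<inter> b | a b. a \<in> A \<and> b \<in> B}"
  then obtain a b a' b' where u: "u = a \<inter> b" and v: "v = a' \<inter> b'"
    and ab: "a \<in> A" "a' \<in> A" "b \<in> B" "b' \<in> B"
    by blast
  have "u \<inter> v = (a \<inter> a') \<inter> (b \<inter> b')" unfolding u v by blast
  moreover have "a \<inter> a' \<in> A" "b \<inter> b' \<in> B"
    using ab assms by (simp_all add: Int_stableD)
  ultimately show "u \<inter> v \<in> {a \<inter> b | a b. a \<in> A \<and> b \<in> B}"
    by blast
qed

section \<open>Meets and joins of complete sub-\<open>\<sigma>\<close>-fields\<close>

lemma sets_sigma_complete_subfield:
  assumes "X \<in> complete_subfields M"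
  shows "sets (sigma (space M) X) = X"
  using assms sigma_algebra.sets_measure_of_eq by (auto simp: complete_subfields_def)

lemma complete_subfields_Int:
  assumes "X \<in> complete_subfields M" "Y \<in> complete_subfields M"
  shows "X \<inter> Y \<in> complete_subfields M"
  using assms unfolding complete_subfields_def sigma_algebra_iff2 by auto

lemma complete_subfields_sigma_join:
  assumes "X \<in> complete_subfields M" "Y \<in> complete_subfields M"
  shows "sigma_join M X Y \<in> complete_subfields M"
proof -
  have s: "X \<union> Y \<subseteq> sets M" using assms by (auto simp: complete_subfields_def)
  have "sigma_algebra (space M) (sigma_join M X Y)"
    unfolding sigma_join_def by (rule sigma_algebra_sigma_sets[OF subset_trans[OF s sets.space_closed]])
  moreover have "sigma_join M X Y \<subseteq> sets M"
    unfolding sigma_join_def using s by (rule sets.sigma_sets_subset)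
  moreover have "zero_one_events M \<subseteq> sigma_join M X Y"
    using assms unfolding sigma_join_def complete_subfields_def
    by (blast intro: sigma_sets.Basic)
  ultimately show ?thesis by (simp add: complete_subfields_def)
qed

text \<open>The union \<open>X \<union> Y\<close> need not be stable under intersection, whereas the
  family of all \<open>a \<inter> b\<close> is. It contains \<open>X\<close> and \<open>Y\<close>,
  by taking \<open>space M\<close> as the other factor, so it generates the same join.\<close>

lemma sigma_join_eq_sigma_sets_Int:
  assumes "X \<in> complete_subfields M" "Y \<in> complete_subfields M"
  shows "sigma_join M X Y = sigma_sets (space M) {a \<inter> b | a b. a \<in> X \<and> b \<in> Y}"
    (is "_ = sigma_sets _ ?G")
proof -
  interpret X: sigma_algebra "space M" X using assms by (simp add: complete_subfields_def)
  interpret Y: sigma_algebra "space M" Y using assms by (simp add: complete_subfields_def)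
  interpret J: sigma_algebra "space M" "sigma_join M X Y"
    using complete_subfields_sigma_join[OF assms] by (simp add: complete_subfields_def)
  have "a \<in> ?G" if "a \<in> X" for a
    using that X.sets_into_space[OF that] by (intro CollectI exI[of _ a] exI[of _ "space M"]) auto
  moreover have "b \<in> ?G" if "b \<in> Y" for b
    using that Y.sets_into_space[OF that] by (intro CollectI exI[of _ "space M"] exI[of _ b]) auto
  ultimately have "sigma_join M X Y \<subseteq> sigma_sets (space M) ?G"
    unfolding sigma_join_def by (intro sigma_sets_mono') blast
  moreover have "?G \<subseteq> sigma_join M X Y"
    by (auto simp: sigma_join_def intro!: J.Int[unfolded sigma_join_def])
  then have "sigma_sets (space M) ?G \<subseteq> sigma_join M X Y"
    by (rule J.sigma_sets_subset)
  ultimately show ?thesis by simp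
qed

section \<open>Measurability up to null events, integrability and independence\<close>

context prob_space
begin

lemma finite_measure_subalgebra_complete_subfield:
  assumes "X \<in> complete_subfields M"
  shows "finite_measure_subalgebra M (sigma (space M) X)"
proof unfold_locales
  show "subalgebra M (sigma (space M) X)"
    using assms sets_sigma_complete_subfield[OF assms]
    by (auto simp: subalgebra_def complete_subfields_def space_measure_of_conv)
qed

lemma subalgebra_sigma_mono:
  assumes "X \<in> complete_subfields M" "Y \<in> complete_subfields M" "X \<subseteq> Y"
  shows "subalgebra (sigma (space M) Y) (sigma (space M) X)"
  using assms by (simp add: subalgebra_def sets_sigma_complete_subfield space_measure_of_conv)

text \<open>This is where completeness enters: \<open>f\<close> and \<open>g\<close> differ on an
  event \<open>N\<close> of probability zero, and every event inside \<open>N\<close> again has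
  probability zero, hence lies in \<open>X\<close>. It makes measurability independent of the chosen
  version of a conditional probability.\<close>

lemma borel_measurable_complete_subfield_AE:
  fixes f g :: "'a \<Rightarrow> real"
  assumes X: "X \<in> complete_subfields M" and f: "f \<in> borel_measurable M"
    and g: "g \<in> borel_measurable (sigma (space M) X)" and ae: "AE x in M. f x = g x"
  shows "f \<in> borel_measurable (sigma (space M) X)"
proof -
  interpret X: sigma_algebra "space M" X using X by (simp add: complete_subfields_def)
  interpret S: finite_measure_subalgebra M "sigma (space M) X"
    by (rule finite_measure_subalgebra_complete_subfield[OF X])
  have gM: "g \<in> borel_measurable M"
    using measurable_from_subalg[OF S.subalg g] .
  define N where "N = {x \<in> space M. f x \<noteq> g x}"
  have N: "N \<in> events" unfolding N_def using f gM by measurable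
  have N0: "emeasure M N = 0" using AE_E2[OF ae] by (simp add: N_def)
  have null: "E \<in> X" if "E \<in> events" "E \<subseteq> N" for E
  proof -
    have "emeasure M E \<le> 0" using emeasure_mono[OF that(2) N] N0 by simp
    then have "prob E = 0" by (simp add: measure_def)
    then show ?thesis
      using X that(1) by (auto simp: complete_subfields_def zero_one_events_def)
  qed
  show ?thesis
  proof (rule measurableI)
    fix S :: "real set" assume S: "S \<in> sets borel"
    \<comment> \<open>Off \<open>N\<close> the preimages under \<open>f\<close> and \<open>g\<close>
      coincide; what remains is an event inside \<open>N\<close>.\<close>
    have eq: "f -` S \<inter> space M = (g -` S \<inter> space M - N) \<union> (f -` S \<inter> space M \<inter> N)"
      by (auto simp: N_def)
    have "f -` S \<inter> space M \<inter> N \<in> X"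
      using measurable_sets[OF f S] N by (intro null) auto
    moreover have "g -` S \<inter> space M \<in> X"
      using measurable_sets[OF g S] sets_sigma_complete_subfield[OF X]
      by (simp add: space_measure_of_conv)
    moreover have "N \<in> X" using N by (intro null) auto
    ultimately have "f -` S \<inter> space M \<in> X" by (subst eq) (intro X.Un X.Diff)
    then show "f -` S \<inter> space (sigma (space M) X) \<in> sets (sigma (space M) X)"
      by (simp only: sets_sigma_complete_subfield[OF X] space_measure_of_conv)
  qed simp
qed

lemma integrable_indicator_event: "A \<in> events \<Longrightarrow> integrable M (indicat_real A)"
  by (simp add: less_top[symmetric])

lemma integrable_cond_prob_given_mult:
  assumes "X \<in> complete_subfields M" "a \<in> events" "c \<in> events"
  shows "integrable M (\<lambda>x. cond_prob_given M X a x * indicator c x)"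
proof -
  interpret S: finite_measure_subalgebra M "sigma (space M) X"
    by (rule finite_measure_subalgebra_complete_subfield[OF assms(1)])
  have "integrable M (cond_prob_given M X a)"
    unfolding cond_prob_given_def using assms
    by (intro S.real_cond_exp_int integrable_indicator_event)
  then show ?thesis using assms by (intro integrable_real_mult_indicator)
qed

text \<open>The \<open>\<sigma>\<close>-fields generated by \<open>f\<close> and \<open>g\<close>
  lie inside \<open>X\<close> and \<open>Y\<close>, so they inherit independence. Stated as
  \<open>indep_var\<close>, this lets expectations of products factorize.\<close>

lemma indep_var_borel_of_indep_set:
  fixes f g :: "'a \<Rightarrow> real"
  assumes XY: "X \<in> complete_subfields M" "Y \<in> complete_subfields M" "indep_set X Y"
    and f: "f \<in> borel_measurable (sigma (space M) X)"
    and g: "g \<in> borel_measurable (sigma (space M) Y)"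
  shows "indep_var borel f borel g"
proof -
  have *: "h \<in> borel_measurable M" "sigma_sets (space M) {h -` A \<inter> space M | A. A \<in> sets borel} \<subseteq> V"
    if V: "V \<in> complete_subfields M" and h: "h \<in> borel_measurable (sigma (space M) V)"
    for h :: "'a \<Rightarrow> real" and V
  proof -
    interpret V: sigma_algebra "space M" V using V by (simp add: complete_subfields_def)
    interpret S: finite_measure_subalgebra M "sigma (space M) V"
      by (rule finite_measure_subalgebra_complete_subfield[OF V])
    show "h \<in> borel_measurable M" using measurable_from_subalg[OF S.subalg h] .
    show "sigma_sets (space M) {h -` A \<inter> space M | A. A \<in> sets borel} \<subseteq> V"
      using measurable_sets[OF h] sets_sigma_complete_subfield[OF V]
      by (intro V.sigma_sets_subset) (auto simp: space_measure_of_conv)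
  qed
  note X = *[OF XY(1) f] and Y = *[OF XY(2) g]
  show ?thesis
    unfolding indep_var_eq
  proof (intro conjI X(1) Y(1) indep_setI)
    show "prob (a \<inter> b) = prob a * prob b"
      if "a \<in> sigma_sets (space M) {f -` A \<inter> space M | A. A \<in> sets borel}"
        and "b \<in> sigma_sets (space M) {g -` A \<inter> space M | A. A \<in> sets borel}" for a b
      using that X(2) Y(2) by (intro indep_setD[OF XY(3)] subsetD[of _ X] subsetD[of _ Y])
  qed (rule subset_trans[OF X(2) indep_setD_ev1[OF XY(3)]],
       rule subset_trans[OF Y(2) indep_setD_ev2[OF XY(3)]])
qed

section \<open>Product formula for conditional probabilities given a join\<close>

text \<open>Over a generating event \<open>c \<inter> d\<close> both sides integrate to
  \<open>prob (a \<inter> c) * prob (b \<inter> d)\<close>: the left one because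
  \<open>a \<inter> c\<close> and \<open>b \<inter> d\<close> are independent, the right one because
  its factors, cut down to \<open>c\<close> and \<open>d\<close>, are independent variables.\<close>

lemma cond_prob_given_sigma_join_Int:
  assumes X: "X \<in> complete_subfields M" and Y: "Y \<in> complete_subfields M"
    and ind: "indep_set X Y"
    and A: "A \<in> complete_subfields M" "A \<subseteq> X" and B: "B \<in> complete_subfields M" "B \<subseteq> Y"
    and a: "a \<in> X" and b: "b \<in> Y"
  shows "AE x in M. cond_prob_given M (sigma_join M A B) (a \<inter> b) x
      = cond_prob_given M A a x * cond_prob_given M B b x"
proof -
  let ?W = "sigma_join M A B"
  let ?G = "{c \<inter> d | c d. c \<in> A \<and> d \<in> B}"
  let ?f = "cond_prob_given M A a" and ?g = "cond_prob_given M B b"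
  have W: "?W \<in> complete_subfields M" using A B by (simp add: complete_subfields_sigma_join)
  have sub: "X \<subseteq> events" "Y \<subseteq> events" using X Y by (auto simp: complete_subfields_def)
  interpret X: sigma_algebra "space M" X using X by (simp add: complete_subfields_def)
  interpret Y: sigma_algebra "space M" Y using Y by (simp add: complete_subfields_def)
  interpret A: sigma_algebra "space M" A using A by (simp add: complete_subfields_def)
  interpret B: sigma_algebra "space M" B using B by (simp add: complete_subfields_def)
  interpret SA: finite_measure_subalgebra M "sigma (space M) A"
    by (rule finite_measure_subalgebra_complete_subfield[OF A(1)])
  interpret SB: finite_measure_subalgebra M "sigma (space M) B"
    by (rule finite_measure_subalgebra_complete_subfield[OF B(1)])
  interpret SW: finite_measure_subalgebra M "sigma (space M) ?W"
    by (rule finite_measure_subalgebra_complete_subfield[OF W])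
  have AW: "A \<subseteq> ?W" and BW: "B \<subseteq> ?W" by (auto simp: sigma_join_def)
  have fA: "?f \<in> borel_measurable (sigma (space M) A)"
    and gB: "?g \<in> borel_measurable (sigma (space M) B)"
    by (auto simp: cond_prob_given_def)
  have key: "integrable M (\<lambda>x. (?f x * indicator c x) * (?g x * indicator d x))"
    "(\<integral>x. (?f x * indicator c x) * (?g x * indicator d x) \<partial>M) = prob (a \<inter> c) * prob (b \<inter> d)"
    if c: "c \<in> A" and d: "d \<in> B" for c d
  proof -
    have cM: "c \<in> events" "d \<in> events" "a \<in> events" "b \<in> events" using c d a b A(2) B(2) sub by auto
    have c': "c \<in> sets (sigma (space M) A)" and d': "d \<in> sets (sigma (space M) B)"
      using c d by (simp_all only: sets_sigma_complete_subfield A(1) B(1))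
    have i: "integrable M (\<lambda>x. ?f x * indicator c x)" "integrable M (\<lambda>x. ?g x * indicator d x)"
      using cM A(1) B(1) by (auto intro: integrable_cond_prob_given_mult)
    have "(\<lambda>x. ?f x * indicator c x) \<in> borel_measurable (sigma (space M) A)"
      using fA c' by measurable
    \<comment> \<open>Measurability is lifted from \<open>A\<close> to \<open>X\<close>, and below
      from \<open>B\<close> to \<open>Y\<close>, because independence is given for the larger
      pair.\<close>
    then have 1: "(\<lambda>x. ?f x * indicator c x) \<in> borel_measurable (sigma (space M) X)"
      using subalgebra_sigma_mono[OF A(1) X A(2)] by (rule measurable_from_subalg[rotated])
    have "(\<lambda>x. ?g x * indicator d x) \<in> borel_measurable (sigma (space M) B)"
      using gB d' by measurable
    then have 2: "(\<lambda>x. ?g x * indicator d x) \<in> borel_measurable (sigma (space M) Y)"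
      using subalgebra_sigma_mono[OF B(1) Y B(2)] by (rule measurable_from_subalg[rotated])
    note iv = indep_var_borel_of_indep_set[OF X Y ind 1 2]
    show "integrable M (\<lambda>x. (?f x * indicator c x) * (?g x * indicator d x))"
      by (rule indep_var_integrable[OF iv i])
    have "(\<integral>x. ?f x * indicator c x \<partial>M) = prob (a \<inter> c)"
      using SA.real_cond_exp_intA[OF integrable_indicator_event c'] cM
      by (simp add: cond_prob_given_def set_lebesgue_integral_def indicator_inter_arith[symmetric] ac_simps)
    moreover have "(\<integral>x. ?g x * indicator d x \<partial>M) = prob (b \<inter> d)"
      using SB.real_cond_exp_intA[OF integrable_indicator_event d'] cM
      by (simp add: cond_prob_given_def set_lebesgue_integral_def indicator_inter_arith[symmetric] ac_simps)
    ultimately show "(\<integral>x. (?f x * indicator c x) * (?g x * indicator d x) \<partial>M) = prob (a \<inter> c) * prob (b \<inter> d)"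
      using indep_var_lebesgue_integral[OF iv i] by simp
  qed
  have ab: "a \<inter> b \<in> events" using a b sub by auto
  show ?thesis
    unfolding cond_prob_given_def[of M ?W]
  proof (rule SW.real_cond_exp_charact_generator[of ?G])
    show "Int_stable ?G"
      by (rule Int_stable_pairwise_Int) (auto intro: A.Int_stable B.Int_stable)
    have "A \<subseteq> events" "B \<subseteq> events" using A(2) B(2) sub by auto
    then show "?G \<subseteq> events" by (auto intro!: sets.Int)
    show "space M \<in> ?G" by (auto intro!: exI[of _ "space M"])
    show "sets (sigma (space M) ?W) = sigma_sets (space M) ?G"
      using sets_sigma_complete_subfield[OF W]
      by (simp only: sigma_join_eq_sigma_sets_Int[OF A(1) B(1)])
    show "integrable M (indicat_real (a \<inter> b))" using ab by (rule integrable_indicator_event)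
    \<comment> \<open>A product of integrable functions is not integrable in general; here
      independence makes it so, through \<open>key\<close> with
      \<open>c = d = space M\<close>.\<close>
    have "integrable M (\<lambda>x. (?f x * indicator (space M) x) * (?g x * indicator (space M) x))"
      by (rule key) auto
    also have "?this \<longleftrightarrow> integrable M (\<lambda>x. ?f x * ?g x)"
      by (rule Bochner_Integration.integrable_cong) auto
    finally show "integrable M (\<lambda>x. ?f x * ?g x)" .
    have "?f \<in> borel_measurable (sigma (space M) ?W)" "?g \<in> borel_measurable (sigma (space M) ?W)"
      using measurable_from_subalg[OF subalgebra_sigma_mono[OF A(1) W AW] fA]
        measurable_from_subalg[OF subalgebra_sigma_mono[OF B(1) W BW] gB] by auto
    then show "(\<lambda>x. ?f x * ?g x) \<in> borel_measurable (sigma (space M) ?W)" by measurable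
    fix u assume "u \<in> ?G"
    then obtain c d where u: "u = c \<inter> d" and c: "c \<in> A" and d: "d \<in> B" by blast
    have ev: "a \<inter> c \<in> X" "b \<inter> d \<in> Y"
      using a b c d A(2) B(2) by (auto intro!: X.Int Y.Int)
    have "(\<integral>x\<in>u. indicat_real (a \<inter> b) x \<partial>M) = prob ((a \<inter> c) \<inter> (b \<inter> d))"
      using u a b c d A(2) B(2) sub
      by (simp add: set_lebesgue_integral_def indicator_inter_arith[symmetric] ac_simps)
    also have "\<dots> = prob (a \<inter> c) * prob (b \<inter> d)" by (rule indep_setD[OF ind ev])
    also have "\<dots> = (\<integral>x\<in>u. ?f x * ?g x \<partial>M)"
      unfolding key(2)[OF c d, symmetric] u set_lebesgue_integral_def
      by (simp add: indicator_inter_arith ac_simps)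
    finally show "(\<integral>x\<in>u. indicat_real (a \<inter> b) x \<partial>M) = (\<integral>x\<in>u. ?f x * ?g x \<partial>M)" .
  qed
qed

end

section \<open>The equivalence of splitting and conditional independence\<close>

theorem proposition3p17:
  fixes M :: "'a measure" and X Y Z :: "'a set set"
  assumes "prob_space M"
    and "X \<in> complete_subfields M" and "Y \<in> complete_subfields M"
    and "Z \<in> complete_subfields M"
    and "prob_space.indep_set M X Y"
    and "Z \<subseteq> sigma_join M X Y"
  shows "(Z = sigma_join M (X \<inter> Z) (Y \<inter> Z) \<longleftrightarrow> is_complement M (X \<inter> Z) (Y \<inter> Z) Z) \<and>
    (Z = sigma_join M (X \<inter> Z) (Y \<inter> Z) \<longleftrightarrow>
      cond_indep_given M Z X Y \<and>
      (\<forall>B\<in>Y. cond_prob_given M Z B \<in> borel_measurable (sigma (space M) Y)) \<and>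
      (\<forall>A\<in>X. cond_prob_given M Z A \<in> borel_measurable (sigma (space M) X)))"
proof -
  interpret prob_space M by fact
  note X = assms(2) and Y = assms(3) and Z = assms(4) and ind = assms(5) and ZXY = assms(6)
  let ?A = "X \<inter> Z" and ?B = "Y \<inter> Z"
  let ?W = "sigma_join M ?A ?B"
  let ?G = "{a \<inter> b | a b. a \<in> X \<and> b \<in> Y}"
  have A: "?A \<in> complete_subfields M" and B: "?B \<in> complete_subfields M"
    using X Y Z by (simp_all add: complete_subfields_Int)
  have W: "?W \<in> complete_subfields M" using A B by (rule complete_subfields_sigma_join)
  have XY: "sigma_join M X Y \<in> complete_subfields M" using X Y by (rule complete_subfields_sigma_join)
  have sub: "X \<subseteq> events" "Y \<subseteq> events" "Z \<subseteq> events"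
    using X Y Z by (auto simp: complete_subfields_def)
  interpret X: sigma_algebra "space M" X using X by (simp add: complete_subfields_def)
  interpret Y: sigma_algebra "space M" Y using Y by (simp add: complete_subfields_def)
  interpret Z: sigma_algebra "space M" Z using Z by (simp add: complete_subfields_def)
  interpret SZ: finite_measure_subalgebra M "sigma (space M) Z"
    by (rule finite_measure_subalgebra_complete_subfield[OF Z])
  interpret SW: finite_measure_subalgebra M "sigma (space M) ?W"
    by (rule finite_measure_subalgebra_complete_subfield[OF W])
  interpret SXY: finite_measure_subalgebra M "sigma (space M) (sigma_join M X Y)"
    by (rule finite_measure_subalgebra_complete_subfield[OF XY])
  have WZ: "?W \<subseteq> Z"
    unfolding sigma_join_def by (rule Z.sigma_sets_subset) auto
  \<comment> \<open>The order is reversed because \<open>is_complement\<close> lists the complement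
    first but forms the independence and the join with it second.\<close>
  have indBA: "indep_set ?B ?A"
  proof (rule indep_setI)
    fix b a assume "b \<in> ?B" "a \<in> ?A"
    then show "prob (b \<inter> a) = prob b * prob a"
      using indep_setD[OF ind, of a b] by (simp add: ac_simps)
  qed (use sub in auto)
  have comm: "sigma_join M ?B ?A = ?W"
    by (simp add: sigma_join_def Un_commute)
  have cond_meas: "cond_prob_given M V F \<in> borel_measurable M"
    for V F unfolding cond_prob_given_def by (rule borel_measurable_cond_exp2)
  \<comment> \<open>The two meets are automatically complete and independent, so being a complement
    reduces to the identity for the join.\<close>
  have one: "Z = ?W \<longleftrightarrow> is_complement M ?A ?B Z"
    unfolding is_complement_def comm using A B indBA by blast
  have measA: "cond_prob_given M Z a \<in> borel_measurable (sigma (space M) V)"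
    if V: "V \<in> complete_subfields M" and U: "U \<in> complete_subfields M" "U \<subseteq> V"
      and ae: "AE x in M. cond_prob_given M Z a x = cond_prob_given M U a x" for a U V
  proof (rule borel_measurable_complete_subfield_AE[OF V cond_meas _ ae])
    have "cond_prob_given M U a \<in> borel_measurable (sigma (space M) U)"
      by (simp add: cond_prob_given_def)
    then show "cond_prob_given M U a \<in> borel_measurable (sigma (space M) V)"
      by (rule measurable_from_subalg[OF subalgebra_sigma_mono[OF U(1) V U(2)]])
  qed
  \<comment> \<open>Putting \<open>space M\<close> for one of the two events reduces the product
    formula to a single conditional probability, as \<open>ca\<close> and \<open>cb\<close> below
    exploit.\<close>
  have cond_space: "AE x in M. cond_prob_given M V (space M) x = 1"
    if V: "V \<in> complete_subfields M" for V
  proof -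
    interpret S: finite_measure_subalgebra M "sigma (space M) V"
      by (rule finite_measure_subalgebra_complete_subfield[OF V])
    have "AE x in M. cond_prob_given M V (space M) x = indicator (space M) x"
      unfolding cond_prob_given_def
    proof (rule S.real_cond_exp_F_meas)
      show "integrable M (indicat_real (space M))" by (intro integrable_indicator_event sets.top)
      show "indicat_real (space M) \<in> borel_measurable (sigma (space M) V)"
        using sets.top[of "sigma (space M) V"]
        by (intro borel_measurable_indicator) (simp only: space_measure_of_conv)
    qed
    then show ?thesis by (rule AE_mp) (auto intro!: AE_I2)
  qed
  have fwd: "cond_indep_given M Z X Y \<and>
      (\<forall>B\<in>Y. cond_prob_given M Z B \<in> borel_measurable (sigma (space M) Y)) \<and>
      (\<forall>A\<in>X. cond_prob_given M Z A \<in> borel_measurable (sigma (space M) X))"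
    if ZW: "Z = ?W"
  proof -
    have prod: "AE x in M. cond_prob_given M Z (a \<inter> b) x
        = cond_prob_given M ?A a x * cond_prob_given M ?B b x" if "a \<in> X" "b \<in> Y" for a b
      using cond_prob_given_sigma_join_Int[OF X Y ind A Int_lower1 B Int_lower1 that] ZW by simp
    have ca: "AE x in M. cond_prob_given M Z a x = cond_prob_given M ?A a x" if "a \<in> X" for a
      using prod[OF that Y.top] cond_space[OF B]
      unfolding Int_absorb2[OF X.sets_into_space[OF that]] by eventually_elim simp
    have cb: "AE x in M. cond_prob_given M Z b x = cond_prob_given M ?B b x" if "b \<in> Y" for b
      using prod[OF X.top that] cond_space[OF A]
      unfolding Int_absorb1[OF Y.sets_into_space[OF that]] by eventually_elim simp
    have "AE x in M. cond_prob_given M Z (a \<inter> b) x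
        = cond_prob_given M Z a x * cond_prob_given M Z b x" if "a \<in> X" "b \<in> Y" for a b
      using prod[OF that] ca[OF that(1)] cb[OF that(2)] by eventually_elim simp
    then have "cond_indep_given M Z X Y" by (simp add: cond_indep_given_def)
    then show ?thesis
      using measA[OF X A Int_lower1 ca] measA[OF Y B Int_lower1 cb] by blast
  qed
  have bwd: "Z = ?W"
    if ci: "cond_indep_given M Z X Y"
      and mY: "\<And>b. b \<in> Y \<Longrightarrow> cond_prob_given M Z b \<in> borel_measurable (sigma (space M) Y)"
      and mX: "\<And>a. a \<in> X \<Longrightarrow> cond_prob_given M Z a \<in> borel_measurable (sigma (space M) X)"
  proof -
    \<comment> \<open>Preimages lie in both families. Thus \<open>cond_prob_given M Z a\<close>,
      measurable for \<open>X\<close> by hypothesis and for \<open>Z\<close> by construction, is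
      measurable for \<open>?A\<close>; likewise for \<open>b\<close> and \<open>?B\<close>.\<close>
    have meas_Int: "f \<in> borel_measurable (sigma (space M) (U \<inter> V))"
      if "U \<in> complete_subfields M" "V \<in> complete_subfields M"
        and "f \<in> borel_measurable (sigma (space M) U)" "f \<in> borel_measurable (sigma (space M) V)"
      for U V and f :: "'a \<Rightarrow> real"
      using that(3,4) complete_subfields_Int[OF that(1,2)] that(1,2)
      by (simp add: measurable_def sets_sigma_complete_subfield space_measure_of_conv)
    have mZ: "cond_prob_given M Z F \<in> borel_measurable (sigma (space M) Z)" for F
      by (simp add: cond_prob_given_def)
    \<comment> \<open>Conditional independence gives an almost sure factorization into functions
      measurable for \<open>?A\<close> and \<open>?B\<close>; completeness of \<open>?W\<close>
      transfers measurability to the chosen version.\<close>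
    have mW: "cond_prob_given M Z (a \<inter> b) \<in> borel_measurable (sigma (space M) ?W)"
      if a: "a \<in> X" and b: "b \<in> Y" for a b
    proof (rule borel_measurable_complete_subfield_AE[OF W cond_meas])
      show "AE x in M. cond_prob_given M Z (a \<inter> b) x
          = cond_prob_given M Z a x * cond_prob_given M Z b x"
        using ci a b by (simp add: cond_indep_given_def)
      have "?A \<subseteq> ?W" "?B \<subseteq> ?W" by (auto simp: sigma_join_def)
      then have "cond_prob_given M Z a \<in> borel_measurable (sigma (space M) ?W)"
          "cond_prob_given M Z b \<in> borel_measurable (sigma (space M) ?W)"
        using measurable_from_subalg[OF subalgebra_sigma_mono[OF A W] meas_Int[OF X Z mX[OF a] mZ]]
          measurable_from_subalg[OF subalgebra_sigma_mono[OF B W] meas_Int[OF Y Z mY[OF b] mZ]]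
        by auto
      then show "(\<lambda>x. cond_prob_given M Z a x * cond_prob_given M Z b x)
          \<in> borel_measurable (sigma (space M) ?W)" by measurable
    qed
    have "z \<in> ?W" if z: "z \<in> Z" for z
    proof -
      let ?g = "cond_prob_given M ?W z"
      have zM: "z \<in> events" using z sub by auto
      have gW: "?g \<in> borel_measurable (sigma (space M) ?W)" by (simp add: cond_prob_given_def)
      then have gZ: "?g \<in> borel_measurable (sigma (space M) Z)"
        by (rule measurable_from_subalg[OF subalgebra_sigma_mono[OF W Z WZ]])
      then have gXY: "?g \<in> borel_measurable (sigma (space M) (sigma_join M X Y))"
        by (rule measurable_from_subalg[OF subalgebra_sigma_mono[OF Z XY ZXY]])
      have gi: "integrable M ?g"
        unfolding cond_prob_given_def using zM by (intro SW.real_cond_exp_int integrable_indicator_event)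
      have zZ: "indicat_real z \<in> borel_measurable (sigma (space M) Z)"
        using z by (intro borel_measurable_indicator) (simp only: sets_sigma_complete_subfield[OF Z])
      \<comment> \<open>The conditional expectation of the indicator of \<open>z\<close> given the
        large join is computed in two ways: here as \<open>?g\<close>, and afterwards as the
        indicator itself, since \<open>Z\<close> lies in that join.\<close>
      have "AE x in M. real_cond_exp M (sigma (space M) (sigma_join M X Y)) (indicator z) x = ?g x"
      proof (rule SXY.real_cond_exp_charact_generator[of ?G])
        show "Int_stable ?G"
          by (rule Int_stable_pairwise_Int) (auto intro: X.Int_stable Y.Int_stable)
        show "?G \<subseteq> events" using sub(1,2) by (auto intro!: sets.Int)
        show "space M \<in> ?G" by (auto intro!: exI[of _ "space M"])
        show "sets (sigma (space M) (sigma_join M X Y)) = sigma_sets (space M) ?G"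
          using sets_sigma_complete_subfield[OF XY]
          by (simp only: sigma_join_eq_sigma_sets_Int[OF X Y])
        show "integrable M (indicat_real z)" using zM by (rule integrable_indicator_event)
        show "integrable M ?g" by (rule gi)
        show "?g \<in> borel_measurable (sigma (space M) (sigma_join M X Y))" by (rule gXY)
        fix u assume "u \<in> ?G"
        then obtain a b where u: "u = a \<inter> b" and a: "a \<in> X" and b: "b \<in> Y" by blast
        let ?p = "cond_prob_given M Z u"
        have uM: "u \<in> events" using u a b sub by auto
        have pW: "?p \<in> borel_measurable (sigma (space M) ?W)" unfolding u using a b by (rule mW)
        have pi: "integrable M (\<lambda>x. ?p x * indicator z x)"
          using Z uM zM by (rule integrable_cond_prob_given_mult)
        have ug: "integrable M (\<lambda>x. ?g x * indicator u x)"
          using W zM uM by (rule integrable_cond_prob_given_mult)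
        \<comment> \<open>Conditioning is moved between factors three times: \<open>u\<close>
          becomes \<open>?p\<close> because the indicator of \<open>z\<close> is
          \<open>Z\<close>-measurable, \<open>z\<close> becomes \<open>?g\<close> because
          \<open>?p\<close> is \<open>?W\<close>-measurable, and \<open>?p\<close> returns to
          \<open>u\<close> because \<open>?g\<close> is \<open>Z\<close>-measurable.\<close>
        have "(\<integral>x\<in>u. indicat_real z x \<partial>M) = (\<integral>x. indicator z x * indicator u x \<partial>M)"
          by (simp add: set_lebesgue_integral_def ac_simps)
        also have "\<dots> = (\<integral>x. indicator z x * ?p x \<partial>M)"
          unfolding cond_prob_given_def using zM uM zZ
          by (intro SZ.real_cond_exp_intg(2)[symmetric] integrable_real_mult_indicator
              integrable_indicator_event) auto
        also have "\<dots> = (\<integral>x. ?p x * indicator z x \<partial>M)" by (simp add: ac_simps)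
        also have "\<dots> = (\<integral>x. ?p x * ?g x \<partial>M)"
          unfolding cond_prob_given_def[of M ?W] using pi pW zM
          by (intro SW.real_cond_exp_intg(2)[symmetric]) auto
        also have "\<dots> = (\<integral>x. ?g x * ?p x \<partial>M)" by (simp add: ac_simps)
        also have "\<dots> = (\<integral>x. ?g x * indicator u x \<partial>M)"
          unfolding cond_prob_given_def[of M Z] using ug gZ uM
          by (intro SZ.real_cond_exp_intg(2)) auto
        also have "\<dots> = (\<integral>x\<in>u. ?g x \<partial>M)"
          by (simp add: set_lebesgue_integral_def ac_simps)
        finally show "(\<integral>x\<in>u. indicat_real z x \<partial>M) = (\<integral>x\<in>u. ?g x \<partial>M)" .
      qed
      moreover have "AE x in M. real_cond_exp M (sigma (space M) (sigma_join M X Y)) (indicator z) x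
          = indicat_real z x"
        using measurable_from_subalg[OF subalgebra_sigma_mono[OF Z XY ZXY] zZ] zM
        by (intro SXY.real_cond_exp_F_meas integrable_indicator_event)
      ultimately have "AE x in M. indicat_real z x = ?g x" by eventually_elim simp
      \<comment> \<open>Completeness of \<open>?W\<close> turns almost sure equality with
        \<open>?g\<close> into exact measurability, hence membership of \<open>z\<close>.\<close>
      then have "indicat_real z \<in> borel_measurable (sigma (space M) ?W)"
        using zM by (intro borel_measurable_complete_subfield_AE[OF W _ gW]) auto
      then have "z \<inter> space M \<in> ?W"
        using borel_measurable_indicator_iff[where 'x = real, of z "sigma (space M) ?W"] sets_sigma_complete_subfield[OF W]
        by (simp add: space_measure_of_conv)
      then show ?thesis using sets.sets_into_space[OF zM] by (simp add: Int_absorb2)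
    qed
    then show ?thesis using WZ by (intro equalityI subsetI) auto
  qed
  show ?thesis using one fwd bwd by (intro conjI iffI) blast+
qed

end
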